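(* Let $S$ be a subset of the set $\mathbb{Z}$ of all integers. Then $S$ is realizable if and only if $S$ is a submonoid of $\mathbb{Z}$.
   Context: For a bijection $f:X\to X$ of a set $X$ and $n\in\mathbb{Z}$, $f^n:X\to X$ denotes the $n$-fold composition of $f$ with itself if $n>0$, the identity map $\mathrm{id}_X$ if $n=0$, and the $(-n)$-fold composition of the inverse map $f^{-1}$ with itself if $n<0$. For a topological space $X$ and a bijection $f:X\to X$ (not assumed continuous), define $\mathcal{C}(X,f)=\{n\in\mathbb{Z}\mid f^n:X\to X \text{ is continuous}\}$. A subset $S\subseteq\mathbb{Z}$ is called realizable if there exist a topological space $X$ and a bijection $f:X\to X$ such that $S=\mathcal{C}(X,f)$. A subset $S\subseteq\mathbb{Z}$ is called a submonoid of $\mathbb{Z}$ if (1) $0\in S$, and (2) whenever $a,b\in S$, also $a+b\in S$. *)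

theory Defs
  imports "HOL-Analysis.Analysis" "HOL-Algebra.Elementary_Groups"
begin

text \<open>A topological space is an abstract topology \<open>X :: 'a topology\<close>, whose underlying set
  \<open>topspace X\<close> may be any subset of the type. A self-bijection of the space is a function
  that is bijective on \<open>topspace X\<close>; its values outside \<open>topspace X\<close> are irrelevant, so the
  inverse map is taken relative to \<open>topspace X\<close>.\<close>

definition int_iterate :: "'a set \<Rightarrow> ('a \<Rightarrow> 'a) \<Rightarrow> int \<Rightarrow> 'a \<Rightarrow> 'a" where
  "int_iterate A f n =
     (if n > 0 then f ^^ nat n
      else if n = 0 then id
      else inv_into A f ^^ nat (- n))"

definition continuity_set :: "'a topology \<Rightarrow> ('a \<Rightarrow> 'a) \<Rightarrow> int set" where
  "continuity_set X f = {n. continuous_map X X (int_iterate (topspace X) f n)}"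

text \<open>HOL cannot quantify over types inside a formula, so the universe \<open>'a\<close> from which the
  points of the space are drawn is a parameter. Every space has a homeomorphic copy carried by a
  subset of some infinite type (for instance, a space with points in \<open>'b\<close> has one in
  \<open>'b + nat\<close>), so infinite universes suffice. Finite ones do not: a space with points in a
  finite type is finite, and on such a space every bijection has finite order.\<close>

definition realizable :: "'a itself \<Rightarrow> int set \<Rightarrow> bool" where
  "realizable _ S \<longleftrightarrow>
     (\<exists>(X :: 'a topology) f. bij_betw f (topspace X) (topspace X) \<and> S = continuity_set X f)"

text \<open>Submonoids of the integers are those of the additive monoid \<^const>\<open>integer_group\<close>.\<close>

lemma submonoid_integer_group_iff:
  "submonoid S integer_group \<longleftrightarrow> 0 \<in> S \<and> (\<forall>a\<in>S. \<forall>b\<in>S. a + b \<in> S)"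
  by (auto simp: submonoid_def integer_group_def)

end

theory Submission
  imports Defs
begin

text \<open>The exponents of continuous iterates form a submonoid because \<open>f\<^sup>0\<close> is the identity and
  \<open>f\<^bsup>a+b\<^esup>\<close> is the composition of \<open>f\<^sup>a\<close> and \<open>f\<^sup>b\<close>.

  Conversely, a submonoid \<open>S\<close> is recovered from its translates: \<open>n + S \<subseteq> S\<close> holds exactly when
  \<open>n \<in> S\<close>, by closure under addition in one direction and by \<open>0 \<in> S\<close> in the other. It is therefore
  enough to find a space on which the \<open>n\<close>-th iterate is continuous if and only if \<open>n + S \<subseteq> S\<close>. Add
  one point \<open>p\<close> to \<open>\<int>\<close>, and let \<open>f\<close> fix \<open>p\<close> and send \<open>k\<close> to \<open>k + 1\<close>. Make every integer an
  isolated point, and give \<open>p\<close> the smallest neighbourhood \<open>{p} \<union> S\<close>. Continuity of \<open>f\<^sup>n\<close> is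
  in question only at \<open>p\<close>, and since \<open>f\<^sup>n\<close> fixes \<open>p\<close>, it holds there if and only if \<open>f\<^sup>n\<close> maps
  \<open>{p} \<union> S\<close> into itself (lemma \<open>continuous_map_focal_iff\<close>). The space is countable, so it has a
  copy in every infinite type.\<close>

section \<open>Integer iterates of a bijection\<close>

lemma int_iterate_in:
  assumes "bij_betw f A A" "x \<in> A"
  shows "int_iterate A f n x \<in> A"
proof -
  have "(f ^^ k) x \<in> A" for k
    by (induction k) (use assms bij_betwE in auto)
  moreover have "(inv_into A f ^^ k) x \<in> A" for k
    by (induction k) (use assms bij_betwE[OF bij_betw_inv_into] in auto)
  ultimately show ?thesis
    using assms(2) by (simp add: int_iterate_def)
qed

text \<open>This recursion holds for exponents of either sign, and it determines the iterates, because
  \<open>f\<close> is injective. The lemmas below use it in place of the case distinction on the sign.\<close>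

lemma int_iterate_plus_1:
  assumes "bij_betw f A A" "x \<in> A"
  shows "int_iterate A f (n + 1) x = f (int_iterate A f n x)"
proof (cases "n \<ge> 0")
  case True
  then have "nat (n + 1) = Suc (nat n)" by simp
  with True show ?thesis by (auto simp: int_iterate_def)
next
  case False
  define k where "k = nat (- (n + 1))"
  have k: "nat (- n) = Suc k" "n + 1 \<le> 0"
    using False by (auto simp: k_def)
  have next_iterate: "int_iterate A f (n + 1) x = (inv_into A f ^^ k) x"
    using k(2) by (auto simp: int_iterate_def k_def)
  then have "(inv_into A f ^^ k) x \<in> f ` A"
    using int_iterate_in[OF assms, of "n + 1"] assms(1) by (simp add: bij_betw_def)
  then have "f (inv_into A f ((inv_into A f ^^ k) x)) = (inv_into A f ^^ k) x"
    by (rule f_inv_into_f)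
  then show ?thesis
    using False k(1) next_iterate by (simp add: int_iterate_def)
qed

lemma int_iterate_unique:
  assumes f: "bij_betw f A A" and "x \<in> A"
    and orbit: "\<And>n. h n \<in> A" "h 0 = x" "\<And>n. h (n + 1) = f (h n)"
  shows "int_iterate A f n x = h n"
proof (induction n rule: int_induct[where k = 0])
  case base
  show ?case by (simp add: int_iterate_def orbit)
next
  case (step1 i)
  then show ?case using assms by (simp add: int_iterate_plus_1)
next
  case (step2 i)
  have "f (int_iterate A f (i - 1) x) = f (h (i - 1))"
    using step2 int_iterate_plus_1[OF f \<open>x \<in> A\<close>, of "i - 1"] orbit(3)[of "i - 1"] by simp
  then show ?case
    using f orbit(1) int_iterate_in[OF f \<open>x \<in> A\<close>] by (auto simp: bij_betw_def dest: inj_onD)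
qed

lemma int_iterate_add:
  assumes f: "bij_betw f A A" and x: "x \<in> A"
  shows "int_iterate A f (a + b) x = int_iterate A f a (int_iterate A f b x)"
proof -
  have "int_iterate A f a (int_iterate A f b x) = int_iterate A f (a + b) x"
  proof (rule int_iterate_unique[OF f int_iterate_in[OF f x]])
    fix n
    show "int_iterate A f (n + 1 + b) x = f (int_iterate A f (n + b) x)"
      using int_iterate_plus_1[OF f x, of "n + b"] by (simp add: algebra_simps)
  qed (simp_all add: int_iterate_in[OF f x])
  then show ?thesis ..
qed

lemma submonoid_continuity_set:
  assumes "bij_betw f (topspace X) (topspace X)"
  shows "submonoid (continuity_set X f) integer_group"
  unfolding submonoid_integer_group_iff
proof (intro conjI ballI)
  show "0 \<in> continuity_set X f"
    by (simp add: continuity_set_def int_iterate_def)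
next
  fix a b assume "a \<in> continuity_set X f" "b \<in> continuity_set X f"
  then have "continuous_map X X (int_iterate (topspace X) f a \<circ> int_iterate (topspace X) f b)"
    by (auto simp: continuity_set_def intro: continuous_map_compose)
  then have "continuous_map X X (int_iterate (topspace X) f (a + b))"
    by (rule continuous_map_eq) (simp add: int_iterate_add[OF assms])
  then show "a + b \<in> continuity_set X f"
    by (simp add: continuity_set_def)
qed

section \<open>Spaces with one non-isolated point\<close>

text \<open>If \<open>p \<in> A\<close> and \<open>T \<subseteq> A\<close>, this is the topology on \<open>A\<close> in which the points other than \<open>p\<close> are
  isolated and \<open>p\<close> has the smallest neighbourhood \<open>insert p T\<close>.\<close>

definition focal_topology :: "'a set \<Rightarrow> 'a \<Rightarrow> 'a set \<Rightarrow> 'a topology" where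
  "focal_topology A p T = topology (\<lambda>U. U \<subseteq> A \<and> (p \<in> U \<longrightarrow> T \<subseteq> U))"

lemma openin_focal: "openin (focal_topology A p T) U \<longleftrightarrow> U \<subseteq> A \<and> (p \<in> U \<longrightarrow> T \<subseteq> U)"
proof -
  have "istopology (\<lambda>U. U \<subseteq> A \<and> (p \<in> U \<longrightarrow> T \<subseteq> U))"
    unfolding istopology_def by blast
  then show ?thesis
    by (simp add: focal_topology_def topology_inverse')
qed

lemma topspace_focal:
  assumes "T \<subseteq> A"
  shows "topspace (focal_topology A p T) = A"
  using assms by (auto simp: topspace_def openin_focal)

text \<open>The other points are isolated, so only continuity at \<open>p\<close> is in question, and since \<open>h p = p\<close>, it means that \<open>h\<close> maps the
  smallest neighbourhood of \<open>p\<close> into itself.\<close>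

lemma continuous_map_focal_iff:
  assumes "T \<subseteq> A" "p \<in> A" "h \<in> A \<rightarrow> A" "h p = p"
  shows "continuous_map (focal_topology A p T) (focal_topology A p T) h
           \<longleftrightarrow> h ` T \<subseteq> insert p T"
proof
  assume h: "continuous_map (focal_topology A p T) (focal_topology A p T) h"
  have "openin (focal_topology A p T) (insert p T)"
    using assms by (auto simp: openin_focal)
  then have "openin (focal_topology A p T) {x \<in> A. h x \<in> insert p T}"
    using openin_continuous_map_preimage[OF h, of "insert p T"]
    by (simp only: topspace_focal[OF assms(1)])
  then show "h ` T \<subseteq> insert p T"
    using assms by (auto simp: openin_focal)
next
  assume "h ` T \<subseteq> insert p T"
  then show "continuous_map (focal_topology A p T) (focal_topology A p T) h"
    using assms by (auto simp: continuous_map_def openin_focal topspace_focal)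
qed

section \<open>Every submonoid is realizable\<close>

lemma submonoid_imp_realizable:
  assumes inf: "infinite (UNIV :: 'a set)" and S: "submonoid S integer_group"
  shows "realizable TYPE('a) S"
proof -
  obtain e :: "nat \<Rightarrow> 'a" where e: "inj e"
    using inf infinite_countable_subset by blast
  \<comment> \<open>\<open>g\<close> embeds \<open>\<int>\<close> with one extra point, which is represented by \<open>None\<close>.\<close>
  define g :: "int option \<Rightarrow> 'a" where "g = e \<circ> to_nat"
  have g: "inj g"
    unfolding g_def using e by (intro inj_compose inj_to_nat)
  define A where "A = range g"
  define T where "T = g ` Some ` S"
  define f where "f = (\<lambda>x. g (map_option ((+) 1) (inv_into UNIV g x)))"
  have f_g: "f (g z) = g (map_option ((+) 1) z)" for z
    by (simp add: f_def g)
  have f: "bij_betw f A A"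
  proof (rule bij_betw_imageI)
    show "inj_on f A"
      by (auto intro!: inj_onI simp: A_def f_g inj_eq[OF g] map_option_case split: option.splits)
    have "g z \<in> f ` A" for z
    proof -
      have "g z = f (g (map_option ((+) (- 1)) z))"
        by (simp add: f_g option.map_comp o_def option.map_ident)
      then show ?thesis by (auto simp: A_def)
    qed
    then show "f ` A = A" by (auto simp: A_def f_g)
  qed
  have iterate: "int_iterate A f n (g z) = g (map_option ((+) n) z)" for n z
    by (rule int_iterate_unique[OF f])
       (auto simp: A_def f_g option.map_comp o_def option.map_ident algebra_simps)
  have TA: "T \<subseteq> A" "g None \<in> A" by (auto simp: T_def A_def)
  have "n \<in> continuity_set (focal_topology A (g None) T) f \<longleftrightarrow> n \<in> S" for n
  proof -
    have "n \<in> continuity_set (focal_topology A (g None) T) f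
            \<longleftrightarrow> int_iterate A f n ` T \<subseteq> insert (g None) T"
      using continuous_map_focal_iff[OF TA, of "int_iterate A f n"] int_iterate_in[OF f]
      by (simp add: continuity_set_def topspace_focal TA iterate)
    also have "\<dots> \<longleftrightarrow> g ` Some ` (+) n ` S \<subseteq> g ` insert None (Some ` S)"
      by (simp add: T_def iterate image_image)
    also have "\<dots> \<longleftrightarrow> (\<forall>s\<in>S. n + s \<in> S)"
      unfolding inj_image_subset_iff[OF g] by auto
    also have "\<dots> \<longleftrightarrow> n \<in> S"
      using S by (auto simp: submonoid_integer_group_iff dest: bspec[where x = 0])
    finally show ?thesis .
  qed
  then have "S = continuity_set (focal_topology A (g None) T) f" by blast
  then show ?thesis
    using f unfolding realizable_def by (metis TA(1) topspace_focal)
qed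

theorem theorem1p2:
  fixes S :: "int set"
  assumes "infinite (UNIV :: 'a set)"
  shows "realizable TYPE('a) S \<longleftrightarrow> submonoid S integer_group"
  using submonoid_imp_realizable[OF assms] submonoid_continuity_set
  by (auto simp: realizable_def)

end
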